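(* Let $Q\subseteq\mathbb{R}^4$ be the unique convex polytope with exactly $12$ facets, centrally symmetric about the origin ($Q=-Q$), whose facet outer normals are parallel to (positive multiples of) the $12$ vectors $$\pm(1,1,0,0),\ \pm(1,0,1,0),\ \pm(1,0,0,1),\ \pm(0,1,1,0),\ \pm(0,1,0,1),\ \pm(0,0,1,1),$$ with each facet having unit $3$-dimensional volume. Then $Q$ is $3$-reliable, but $Q$ is not $3$-decomposable.
   Context: Existence and uniqueness of $Q$ are given by Minkowski's existence theorem. All compact convex sets are nonempty. For a linear subspace $\xi$ of $\mathbb{R}^4$, $K_\xi$ denotes the orthogonal projection of $K$ onto $\xi$. A compact convex set $L\subseteq\mathbb{R}^4$ is $3$-reliable if, for every compact convex $K\subseteq\mathbb{R}^4$ such that $L_\xi$ contains a translate of $K_\xi$ for every $3$-dimensional linear subspace $\xi\subseteq\mathbb{R}^4$, the set $L$ contains a translate of $K$. The set $L$ is $3$-decomposable if there exist a direct sum decomposition into linear subspaces $\mathbb{R}^4=\xi_1\oplus\cdots\oplus\xi_m$ with $\dim\xi_i\le3$ for each $i$, and compact convex sets $L_i\subseteq\xi_i$, such that $L=L_1+\cdots+L_m$ (Minkowski sum). *)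

theory Defs
  imports "HOL-Analysis.Analysis"
begin

definition compact_convex :: "'a::euclidean_space set \<Rightarrow> bool" where
  "compact_convex K \<longleftrightarrow> compact K \<and> convex K \<and> K \<noteq> {}"

definition orth_projection :: "'a::euclidean_space set \<Rightarrow> 'a set \<Rightarrow> 'a set" where
  "orth_projection \<xi> K = {y \<in> \<xi>. \<exists>x\<in>K. x - y \<in> orthogonal_comp \<xi>}"

definition contains_translate :: "'a::euclidean_space set \<Rightarrow> 'a set \<Rightarrow> bool" where
  "contains_translate L K \<longleftrightarrow> (\<exists>t. (+) t ` K \<subseteq> L)"

definition reliable :: "nat \<Rightarrow> 'a::euclidean_space set \<Rightarrow> bool" where
  "reliable d L \<longleftrightarrow>
     (\<forall>K. compact_convex K \<longrightarrow>
        (\<forall>\<xi>. subspace \<xi> \<and> dim \<xi> = d \<longrightarrow>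
           contains_translate (orth_projection \<xi> L) (orth_projection \<xi> K)) \<longrightarrow>
        contains_translate L K)"

definition direct_sum_decomposition :: "nat \<Rightarrow> (nat \<Rightarrow> 'a::euclidean_space set) \<Rightarrow> bool" where
  "direct_sum_decomposition m \<xi> \<longleftrightarrow>
     (\<forall>i\<in>{1..m}. subspace (\<xi> i)) \<and>
     (\<forall>x. \<exists>!f. f \<in> (\<Pi>\<^sub>E i\<in>{1..m}. \<xi> i) \<and> x = (\<Sum>i=1..m. f i))"

text \<open>The sum of the sets \<open>L i\<close> below is the Minkowski sum of \<open>HOL-Library.Set_Algebras\<close>.\<close>

definition decomposable :: "nat \<Rightarrow> 'a::euclidean_space set \<Rightarrow> bool" where
  "decomposable d L \<longleftrightarrow>
     (\<exists>m \<xi> M. direct_sum_decomposition m \<xi> \<and>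
        (\<forall>i\<in>{1..m}. dim (\<xi> i) \<le> d \<and> compact_convex (M i) \<and> M i \<subseteq> \<xi> i) \<and>
        L = (\<Sum>i=1..m. M i))"

definition outer_normal :: "'a::euclidean_space set \<Rightarrow> 'a set \<Rightarrow> 'a \<Rightarrow> bool" where
  "outer_normal P F u \<longleftrightarrow>
     u \<noteq> 0 \<and> (\<exists>b. P \<subseteq> {x. u \<bullet> x \<le> b} \<and> F = P \<inter> {x. u \<bullet> x = b})"

definition unit_facet_normals :: "'a::euclidean_space set \<Rightarrow> 'a set" where
  "unit_facet_normals P = {u. norm u = 1 \<and> (\<exists>F. F facet_of P \<and> outer_normal P F u)}"

text \<open>Three-dimensional volume of a subset of a hyperplane of \<open>\<real>\<^sup>4\<close>: Lebesgue measure
  transported along an isometric embedding of \<open>\<real>\<^sup>3\<close>.  By isometry invariance of Lebesgue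
  measure, \<open>v\<close> does not depend on the embedding.\<close>

definition has_volume3 :: "(real ^ 4) set \<Rightarrow> real \<Rightarrow> bool" where
  "has_volume3 F v \<longleftrightarrow>
     (\<exists>(p :: real ^ 4) (f :: real ^ 3 \<Rightarrow> real ^ 4) S.
        linear f \<and> (\<forall>x. norm (f x) = norm x) \<and>
        F = (\<lambda>x. p + f x) ` S \<and> S \<in> lmeasurable \<and> measure lebesgue S = v)"

definition normal_directions :: "(real ^ 4) set" where
  "normal_directions =
     (let N = {vector [1,1,0,0], vector [1,0,1,0], vector [1,0,0,1],
               vector [0,1,1,0], vector [0,1,0,1], vector [0,0,1,1]}
      in N \<union> uminus ` N)"

text \<open>\<open>sgn v\<close> is the unit vector \<open>v /\<^sub>R norm v\<close>.  Full-dimensionality of \<open>Q\<close> is implied by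
  the facets having positive three-dimensional volume.\<close>

definition minkowski_polytope_Q :: "(real ^ 4) set \<Rightarrow> bool" where
  "minkowski_polytope_Q Q \<longleftrightarrow>
     polytope Q \<and>
     card {F. F facet_of Q} = 12 \<and>
     uminus ` Q = Q \<and>
     unit_facet_normals Q = sgn ` normal_directions \<and>
     (\<forall>F. F facet_of Q \<longrightarrow> has_volume3 F 1)"

end

(* Reliability: a translate by t fits K into Q iff t_i + t_j lies in an interval A_ij for all i < j.
   Each of the three 4-cycles in K_4 has normals e_i + e_j spanning a 3-dimensional space, so the
   shadow on that space shows that two of the intervals A_12 + A_34, A_13 + A_24, A_14 + A_23 meet.
   By Helly in dimension one all three have a common point, and from it t can be solved for.

   Indecomposability: if Q is a sum over a direct sum decomposition, then for a facet normal u the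
   functional u o p (p a component projection) is constant on the facet, hence a multiple of u.
   So every e_i + e_j is an eigenvector of the transpose of p; the eigenvalues agree because of the
   4-cycle relations, p is scalar, and dim < 4 forces p = 0 for every component.

   The volumes of the facets matter only in that they make Q full-dimensional. *)

theory Submission
  imports Defs
begin

section \<open>Facets of full-dimensional polyhedra\<close>

text \<open>Otherwise a segment from an interior point to \<open>x\<close> crosses the frontier,
  hence meets a facet. The hyperplane of that facet leaves the interior point strictly inside and
  \<open>x\<close> weakly inside, so the crossing point can only be \<open>x\<close> itself.\<close>

lemma mem_polyhedron_if_below_facets:
  fixes Q :: "'a::euclidean_space set"
  assumes "polyhedron Q" "interior Q \<noteq> {}"
    and below: "\<And>u. u \<in> unit_facet_normals Q \<Longrightarrow> \<exists>y\<in>Q. u \<bullet> x \<le> u \<bullet> y"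
  shows "x \<in> Q"
proof (rule ccontr)
  assume "x \<notin> Q"
  obtain z where z: "z \<in> interior Q" using assms(2) by blast
  then have "z \<in> Q" using interior_subset by blast
  have "closed_segment z x \<inter> frontier Q \<noteq> {}"
    by (rule connected_Int_frontier) (use \<open>z \<in> Q\<close> \<open>x \<notin> Q\<close> in auto)
  then obtain y where y: "y \<in> closed_segment z x" "y \<in> frontier Q" by blast
  have "y \<in> Q - rel_interior Q"
    using y(2) polyhedron_imp_closed[OF assms(1)] rel_interior_nonempty_interior[OF assms(2)]
    by (simp add: frontier_def)
  then obtain F where F: "F facet_of Q" "y \<in> F"
    using rel_boundary_of_polyhedron[OF assms(1)] by auto
  obtain a b where a: "a \<noteq> 0" "Q \<subseteq> {x. a \<bullet> x \<le> b}" "F = Q \<inter> {x. a \<bullet> x = b}"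
    using facet_of_polyhedron[OF assms(1) F(1)] by metis
  have "outer_normal Q F (sgn a)"
    unfolding outer_normal_def using a
    by (intro conjI exI[of _ "b / norm a"]) (auto simp: sgn_div_norm sgn_zero_iff field_simps)
  then have "sgn a \<in> unit_facet_normals Q"
    using F(1) a(1) by (auto simp: unit_facet_normals_def norm_sgn)
  from below[OF this] obtain y' where "y' \<in> Q" "sgn a \<bullet> x \<le> sgn a \<bullet> y'" by blast
  then have ax: "a \<bullet> x \<le> b"
    using a by (auto simp: sgn_div_norm divide_le_cancel)
  have "interior Q \<subseteq> {x. a \<bullet> x < b}"
    using interior_mono[OF a(2)] a(1) by simp
  then have az: "a \<bullet> z < b" using z by blast
  obtain s where s: "0 \<le> s" "s \<le> 1" "y = (1 - s) *\<^sub>R z + s *\<^sub>R x"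
    using y(1) by (auto simp: in_segment)
  have "a \<bullet> y = b" using F(2) a(3) by auto
  then have eq: "(1 - s) * (a \<bullet> z) + s * (a \<bullet> x) = b"
    using s(3) by (simp add: inner_add_right)
  \<comment> \<open>A convex combination of two nonnegative slacks vanishes; the slack at
    \<open>z\<close> is positive, so its weight \<open>1 - s\<close> is zero.\<close>
  have "(1 - s) * (b - a \<bullet> z) + s * (b - a \<bullet> x) = 0" using eq by (simp add: algebra_simps)
  moreover have "(1 - s) * (b - a \<bullet> z) \<ge> 0" "s * (b - a \<bullet> x) \<ge> 0" using s ax az by auto
  ultimately have "(1 - s) * (b - a \<bullet> z) = 0" by linarith
  then have "s = 1" using az by simp
  then have "y = x" using s(3) by simp
  then show False using F \<open>x \<notin> Q\<close> \<open>y \<in> Q - rel_interior Q\<close> by blast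
qed

text \<open>By dimension the affine hull of \<open>F\<close> is the whole hyperplane with normal
  \<open>u\<close>, so a functional constant on \<open>F\<close> is constant on that
  hyperplane.\<close>

lemma facet_normals_proportional:
  fixes Q :: "'a::euclidean_space set"
  assumes "interior Q \<noteq> {}" "F facet_of Q" "u \<noteq> 0"
    and Fu: "F \<subseteq> {x. u \<bullet> x = b}" and Fw: "F \<subseteq> {x. w \<bullet> x = c}"
  shows "\<exists>\<alpha>. w = \<alpha> *\<^sub>R u"
proof -
  have dimF: "aff_dim F = DIM('a) - 1" "F \<noteq> {}"
    using assms(2) aff_dim_nonempty_interior[OF assms(1)] by (auto simp: facet_of_def)
  have hull: "affine hull F = {x. u \<bullet> x = b}"
  proof (rule affine_dim_equal)
    show "affine hull F \<subseteq> {x. u \<bullet> x = b}"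
      using Fu by (simp add: affine_hyperplane hull_minimal)
    show "aff_dim (affine hull F) = aff_dim {x. u \<bullet> x = b}"
      using dimF assms(3) by (simp add: aff_dim_hyperplane)
  qed (use dimF in \<open>auto simp: affine_hyperplane\<close>)
  have "affine hull F \<subseteq> {x. w \<bullet> x = c}"
    using Fw by (simp add: affine_hyperplane hull_minimal)
  then have sub: "w \<bullet> x = c" if "u \<bullet> x = b" for x using hull that by blast
  obtain y where y: "y \<in> F" using dimF by blast
  \<comment> \<open>This is the component of \<open>w\<close> orthogonal to \<open>u\<close>. Moving
    along it stays in the hyperplane, so \<open>w\<close> cannot see it, and it is orthogonal to
    itself.\<close>
  define z where "z = w - ((u \<bullet> w) / (u \<bullet> u)) *\<^sub>R u"
  have uz: "u \<bullet> z = 0" using assms(3) by (simp add: z_def inner_diff_right)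
  have "w \<bullet> (y + z) = c" using sub[of "y + z"] uz y Fu by (auto simp: inner_add_right)
  then have "w \<bullet> z = 0" using y Fw by (auto simp: inner_add_right)
  have "z \<bullet> z = w \<bullet> z - ((u \<bullet> w) / (u \<bullet> u)) * (u \<bullet> z)"
    by (simp add: z_def inner_diff_left)
  then have "z = 0" using uz \<open>w \<bullet> z = 0\<close> by simp
  then show ?thesis unfolding z_def by auto
qed

section \<open>Shadows and Helly in dimension one\<close>

text \<open>Turns a covering of shadows into a statement about functionals: those given by vectors
  of \<open>\<xi>\<close> ignore the component orthogonal to \<open>\<xi>\<close>, so they take the
  same values on a point and on its shadow.\<close>

lemma contains_translate_projection:
  fixes \<xi> :: "'a::euclidean_space set"
  assumes "subspace \<xi>" "contains_translate (orth_projection \<xi> L) (orth_projection \<xi> K)"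
  obtains t where "\<And>x. x \<in> K \<Longrightarrow> \<exists>q\<in>L. \<forall>u\<in>\<xi>. u \<bullet> (t + x) = u \<bullet> q"
proof -
  obtain t where t: "(+) t ` orth_projection \<xi> K \<subseteq> orth_projection \<xi> L"
    using assms(2) by (auto simp: contains_translate_def)
  have "\<exists>q\<in>L. \<forall>u\<in>\<xi>. u \<bullet> (t + x) = u \<bullet> q" if "x \<in> K" for x
  proof -
    obtain y z where yz: "y \<in> \<xi>" "\<And>w. w \<in> \<xi> \<Longrightarrow> orthogonal z w" "x = y + z"
      using orthogonal_subspace_decomp_exists[of \<xi> x] span_eq_iff[of \<xi>] assms(1) by metis
    then have "y \<in> orth_projection \<xi> K"
      using that by (auto simp: orth_projection_def orthogonal_comp_def orthogonal_commute
          intro!: bexI[of _ x])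
    then have "t + y \<in> orth_projection \<xi> L" using t by blast
    then obtain q where q: "q \<in> L" "q - (t + y) \<in> orthogonal_comp \<xi>"
      by (auto simp: orth_projection_def)
    have "u \<bullet> (t + x) = u \<bullet> q" if "u \<in> \<xi>" for u
      using q(2) yz(2)[OF that] that
      by (auto simp: yz(3) orthogonal_comp_def orthogonal_def inner_add_right inner_diff_right
          inner_commute[of z])
    then show ?thesis using q(1) by blast
  qed
  then show ?thesis using that by blast
qed

text \<open>The median of \<open>p\<close>, \<open>q\<close>, \<open>r\<close> already lies in two
  of the sets, and the other two points place it in the third. The three cases say which point is
  the median.\<close>

lemma convex_real_sets_Int3:
  fixes A B C :: "real set"
  assumes "convex A" "convex B" "convex C"
    and "p \<in> A" "p \<in> B" "q \<in> B" "q \<in> C" "r \<in> A" "r \<in> C"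
  shows "\<exists>x. x \<in> A \<and> x \<in> B \<and> x \<in> C"
proof -
  have iv: "is_interval A" "is_interval B" "is_interval C"
    using assms by (simp_all add: is_interval_convex_1)
  consider "p \<le> q \<and> q \<le> r \<or> r \<le> q \<and> q \<le> p" | "q \<le> p \<and> p \<le> r \<or> r \<le> p \<and> p \<le> q"
    | "p \<le> r \<and> r \<le> q \<or> q \<le> r \<and> r \<le> p" by linarith
  then show ?thesis
  proof cases
    case 1
    then have "q \<in> A" using mem_is_interval_1_I[OF iv(1)] assms by blast
    then show ?thesis using assms by blast
  next
    case 2
    then have "p \<in> C" using mem_is_interval_1_I[OF iv(3)] assms by blast
    then show ?thesis using assms by blast
  next
    case 3
    then have "r \<in> B" using mem_is_interval_1_I[OF iv(2)] assms by blast
    then show ?thesis using assms by blast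
  qed
qed

section \<open>Facet normals as edges of K_4\<close>

definition pair_sum :: "4 \<Rightarrow> 4 \<Rightarrow> real ^ 4" where
  "pair_sum i j = axis i 1 + axis j 1"

lemma inner_pair_sum: "pair_sum i j \<bullet> x = x $ i + x $ j"
  by (simp add: pair_sum_def inner_add_left inner_axis')

lemma pair_sum_commute: "pair_sum i j = pair_sum j i"
  by (simp add: pair_sum_def add.commute)

lemma vector_4:
  "(vector [a, b, c, d] :: 'a::zero ^ 4) $ 1 = a"
  "(vector [a, b, c, d] :: 'a::zero ^ 4) $ 2 = b"
  "(vector [a, b, c, d] :: 'a::zero ^ 4) $ 3 = c"
  "(vector [a, b, c, d] :: 'a::zero ^ 4) $ 4 = d"
  by (simp_all add: vector_def)

lemma vector_eq_pair_sum:
  "vector [1, 1, 0, 0] = pair_sum 1 2" "vector [1, 0, 1, 0] = pair_sum 1 3"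
  "vector [1, 0, 0, 1] = pair_sum 1 4" "vector [0, 1, 1, 0] = pair_sum 2 3"
  "vector [0, 1, 0, 1] = pair_sum 2 4" "vector [0, 0, 1, 1] = pair_sum 3 4"
  by (simp_all add: vec_eq_iff forall_4 vector_4 pair_sum_def axis_def)

lemma normal_directions_eq:
  "normal_directions = {v. \<exists>i j. i \<noteq> j \<and> (v = pair_sum i j \<or> v = - pair_sum i j)}"
proof -
  define N where "N = {pair_sum 1 2, pair_sum 1 3, pair_sum 1 4,
    pair_sum 2 3, pair_sum 2 4, pair_sum 3 4}"
  have "\<forall>i j. i \<noteq> j \<longrightarrow> pair_sum i j \<in> N"
    unfolding forall_4
    by (simp add: N_def pair_sum_commute[of 2 1] pair_sum_commute[of 3 1] pair_sum_commute[of 4 1]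
        pair_sum_commute[of 3 2] pair_sum_commute[of 4 2] pair_sum_commute[of 4 3])
  moreover have "\<exists>i j. i \<noteq> j \<and> v = pair_sum i j" if "v \<in> N" for v
  proof -
    have "(1::4) \<noteq> 2" "(1::4) \<noteq> 3" "(1::4) \<noteq> 4" "(2::4) \<noteq> 3" "(2::4) \<noteq> 4" "(3::4) \<noteq> 4"
      by simp_all
    then show ?thesis using that unfolding N_def by blast
  qed
  moreover have "normal_directions = N \<union> uminus ` N"
    by (simp only: normal_directions_def Let_def vector_eq_pair_sum N_def)
  ultimately show ?thesis by fast
qed

section \<open>Reliability\<close>

text \<open>Six edge values on K_4 are the pair sums of some \<open>t\<close> exactly when the three
  perfect matchings have equal totals. A vector that is good on one 4-cycle gives two matchings a
  common total, since each of the two matchings in the cycle covers all four vertices.\<close>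

lemma exists_pair_sums_in_convex_sets:
  fixes A :: "4 \<Rightarrow> 4 \<Rightarrow> real set"
  assumes conv: "\<And>i j. convex (A i j)" and sym: "\<And>i j. A i j = A j i"
    and cycles: "\<And>i j k l. distinct [i, j, k, l] \<Longrightarrow>
      \<exists>t :: real ^ 4. \<forall>a\<in>{i, j}. \<forall>b\<in>{k, l}. t $ a + t $ b \<in> A a b"
  shows "\<exists>t :: real ^ 4. \<forall>i j. i \<noteq> j \<longrightarrow> t $ i + t $ j \<in> A i j"
proof -
  have meet: "\<exists>s. s \<in> A i k + A j l \<and> s \<in> A i l + A j k" if d: "distinct [i, j, k, l]" for i j k l
  proof -
    obtain t :: "real ^ 4" where t: "\<forall>a\<in>{i, j}. \<forall>b\<in>{k, l}. t $ a + t $ b \<in> A a b"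
      using cycles[OF d] by blast
    have "(t $ i + t $ k) + (t $ j + t $ l) \<in> A i k + A j l"
      using t by (intro set_plus_intro) auto
    moreover have "(t $ i + t $ l) + (t $ j + t $ k) \<in> A i l + A j k"
      using t by (intro set_plus_intro) auto
    ultimately show ?thesis by (intro exI[of _ "t$i + t$j + t$k + t$l"]) (simp add: algebra_simps)
  qed
  \<comment> \<open>The 4-cycle between \<open>{i, j}\<close> and \<open>{k, l}\<close> omits the
    matching made of the edges ij and kl, so the three ways of splitting the indices into pairs
    yield the three pairs of matchings.\<close>
  obtain p where p: "p \<in> A 1 2 + A 3 4" "p \<in> A 1 4 + A 2 3"
    using meet[of 1 3 2 4] by (auto simp: sym[of 3 2])
  obtain q where q: "q \<in> A 1 4 + A 2 3" "q \<in> A 1 3 + A 2 4"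
    using meet[of 1 2 4 3] by auto
  obtain r where r: "r \<in> A 1 2 + A 3 4" "r \<in> A 1 3 + A 2 4"
    using meet[of 1 4 2 3] by (auto simp: sym[of 4 2] sym[of 4 3])
  obtain \<sigma> where \<sigma>: "\<sigma> \<in> A 1 2 + A 3 4" "\<sigma> \<in> A 1 4 + A 2 3" "\<sigma> \<in> A 1 3 + A 2 4"
    using convex_real_sets_Int3[OF _ _ _ p q r] convex_set_plus conv by metis
  obtain s12 s34 where s1: "\<sigma> = s12 + s34" "s12 \<in> A 1 2" "s34 \<in> A 3 4"
    using \<sigma>(1) by (rule set_plus_elim)
  obtain s14 s23 where s2: "\<sigma> = s14 + s23" "s14 \<in> A 1 4" "s23 \<in> A 2 3"
    using \<sigma>(2) by (rule set_plus_elim)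
  obtain s13 s24 where s3: "\<sigma> = s13 + s24" "s13 \<in> A 1 3" "s24 \<in> A 2 4"
    using \<sigma>(3) by (rule set_plus_elim)
  \<comment> \<open>The triangle 1, 2, 3 determines the first three coordinates and
    \<open>s14\<close> the last. The sums for \<open>s24\<close> and \<open>s34\<close> then come
    out right because all matchings have total \<open>\<sigma>\<close>.\<close>
  define t :: "real ^ 4" where
    "t = vector [(s12 + s13 - s23) / 2, (s12 + s23 - s13) / 2, (s13 + s23 - s12) / 2,
      s14 - (s12 + s13 - s23) / 2]"
  have "t $ 1 + t $ 2 = s12" "t $ 1 + t $ 3 = s13" "t $ 1 + t $ 4 = s14"
    "t $ 2 + t $ 3 = s23" "t $ 2 + t $ 4 = s24" "t $ 3 + t $ 4 = s34"
    using s1(1) s2(1) s3(1) by (simp_all add: t_def vector_4 field_simps)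
  then have mem: "t $ 1 + t $ 2 \<in> A 1 2" "t $ 1 + t $ 3 \<in> A 1 3" "t $ 1 + t $ 4 \<in> A 1 4"
    "t $ 2 + t $ 3 \<in> A 2 3" "t $ 2 + t $ 4 \<in> A 2 4" "t $ 3 + t $ 4 \<in> A 3 4"
    using s1(2,3) s2(2,3) s3(2,3) by metis+
  moreover have "t $ j + t $ i \<in> A j i" if "t $ i + t $ j \<in> A i j" for i j
    using that sym[of i j] by (simp add: add.commute)
  ultimately have "\<forall>i j. i \<noteq> j \<longrightarrow> t $ i + t $ j \<in> A i j"
    unfolding forall_4 by simp
  then show ?thesis by blast
qed

lemma reliable_if_pair_sum_normals:
  assumes "polyhedron Q" "interior Q \<noteq> {}"
    and normals: "unit_facet_normals Q \<subseteq> sgn ` normal_directions"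
  shows "reliable 3 Q"
  unfolding reliable_def
proof (intro allI impI)
  fix K
  assume K: "compact_convex K"
    and H: "\<forall>\<xi>. subspace \<xi> \<and> dim \<xi> = 3 \<longrightarrow>
      contains_translate (orth_projection \<xi> Q) (orth_projection \<xi> K)"
  \<comment> \<open>The shifts that keep \<open>K\<close> between the two facet hyperplanes of
    \<open>Q\<close> in this direction, with values attained on \<open>Q\<close> serving as bounds.
    The upper bounds pass to smaller shifts and the lower ones to larger shifts, which makes
    \<open>A i j\<close> an interval.\<close>
  define A where "A i j = {s. \<forall>x\<in>K. (\<exists>y\<in>Q. s + pair_sum i j \<bullet> x \<le> pair_sum i j \<bullet> y) \<and>
      (\<exists>y\<in>Q. pair_sum i j \<bullet> y \<le> s + pair_sum i j \<bullet> x)}" for i j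
  have "\<exists>t. \<forall>i j. i \<noteq> j \<longrightarrow> t $ i + t $ j \<in> A i j"
  proof (rule exists_pair_sums_in_convex_sets)
    fix i j
    show "A i j = A j i" by (simp add: A_def pair_sum_commute[of i])
    have "is_interval (A i j)"
      unfolding is_interval_1
    proof (intro ballI allI impI)
      fix a b s
      assume "a \<in> A i j" "b \<in> A i j" "a \<le> s \<and> s \<le> b"
      then show "s \<in> A i j"
        unfolding A_def mem_Collect_eq by (meson add_right_mono order_trans)
    qed
    then show "convex (A i j)" by (simp add: is_interval_convex_1)
  next
    fix i j k l :: 4
    assume d: "distinct [i, j, k, l]"
    \<comment> \<open>Along the 4-cycle between \<open>{i, j}\<close> and \<open>{k, l}\<close> the
      normals e_a + e_b are all orthogonal to \<open>v\<close>, so the shadow on the hyperplane of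
      \<open>v\<close> controls all four of them.\<close>
    define v :: "real ^ 4" where "v = axis i 1 + axis j 1 - axis k 1 - axis l 1"
    have "v $ i = 1" using d by (simp add: v_def axis_def)
    then have "v \<noteq> 0" by auto
    then have "subspace {x. v \<bullet> x = 0} \<and> dim {x. v \<bullet> x = 0} = 3"
      by (simp add: subspace_hyperplane dim_hyperplane)
    with H obtain t where t: "\<And>x. x \<in> K \<Longrightarrow> \<exists>q\<in>Q. \<forall>u\<in>{x. v \<bullet> x = 0}. u \<bullet> (t + x) = u \<bullet> q"
      by (metis contains_translate_projection)
    have "t $ a + t $ b \<in> A a b" if "a \<in> {i, j}" "b \<in> {k, l}" for a b
    proof -
      have "v $ a + v $ b = 0" using that d by (auto simp: v_def axis_def)
      then have "v \<bullet> pair_sum a b = 0" by (simp add: inner_commute[of v] inner_pair_sum)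
      then show ?thesis
        unfolding A_def mem_Collect_eq
      proof (intro ballI conjI)
        fix x assume "x \<in> K"
        with t obtain q where q: "q \<in> Q" "\<forall>u\<in>{x. v \<bullet> x = 0}. u \<bullet> (t + x) = u \<bullet> q" by blast
        then have "pair_sum a b \<bullet> (t + x) = pair_sum a b \<bullet> q"
          using \<open>v \<bullet> pair_sum a b = 0\<close> by blast
        then have "t $ a + t $ b + pair_sum a b \<bullet> x = pair_sum a b \<bullet> q"
          by (simp add: inner_pair_sum algebra_simps)
        then show "\<exists>y\<in>Q. t $ a + t $ b + pair_sum a b \<bullet> x \<le> pair_sum a b \<bullet> y"
          "\<exists>y\<in>Q. pair_sum a b \<bullet> y \<le> t $ a + t $ b + pair_sum a b \<bullet> x"
          using \<open>q \<in> Q\<close> by auto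
      qed
    qed
    then show "\<exists>t. \<forall>a\<in>{i, j}. \<forall>b\<in>{k, l}. t $ a + t $ b \<in> A a b" by blast
  qed
  then obtain t where t: "\<And>i j. i \<noteq> j \<Longrightarrow> t $ i + t $ j \<in> A i j" by blast
  have "t + x \<in> Q" if "x \<in> K" for x
  proof (rule mem_polyhedron_if_below_facets[OF assms(1,2)])
    fix u assume "u \<in> unit_facet_normals Q"
    then obtain i j where "i \<noteq> j" and u: "u = sgn (pair_sum i j) \<or> u = - sgn (pair_sum i j)"
      using normals unfolding normal_directions_eq by (auto simp: sgn_minus)
    \<comment> \<open>The sign of the facet normal \<open>u\<close> decides which of the two bounds
      is used.\<close>
    have "(\<exists>y\<in>Q. pair_sum i j \<bullet> (t + x) \<le> pair_sum i j \<bullet> y) \<and>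
        (\<exists>y\<in>Q. pair_sum i j \<bullet> y \<le> pair_sum i j \<bullet> (t + x))"
      using t[OF \<open>i \<noteq> j\<close>] that unfolding A_def
      by (simp add: inner_add_right inner_pair_sum[of i j t])
    then obtain y z where "y \<in> Q" "pair_sum i j \<bullet> (t + x) \<le> pair_sum i j \<bullet> y"
      and "z \<in> Q" "pair_sum i j \<bullet> z \<le> pair_sum i j \<bullet> (t + x)" by blast
    moreover have "sgn (pair_sum i j) \<bullet> z = pair_sum i j \<bullet> z / norm (pair_sum i j)" for z
      by (simp add: sgn_div_norm divide_inverse_commute)
    ultimately have "sgn (pair_sum i j) \<bullet> (t + x) \<le> sgn (pair_sum i j) \<bullet> y"
      and "- sgn (pair_sum i j) \<bullet> (t + x) \<le> - sgn (pair_sum i j) \<bullet> z"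
      by (simp_all only: inner_minus_left neg_le_iff_le divide_right_mono norm_ge_zero)
    then show "\<exists>y\<in>Q. u \<bullet> (t + x) \<le> u \<bullet> y"
      using u \<open>y \<in> Q\<close> \<open>z \<in> Q\<close> by blast
  qed
  then show "contains_translate Q K" unfolding contains_translate_def by blast
qed

section \<open>Indecomposability\<close>

text \<open>\<open>p i x\<close> is the component of \<open>x\<close> in \<open>\<xi> i\<close>.
  Linearity and the recovery of given summands both come from uniqueness of the
  decomposition.\<close>

lemma direct_sum_projections:
  fixes \<xi> :: "nat \<Rightarrow> 'a::euclidean_space set"
  assumes "direct_sum_decomposition m \<xi>"
  obtains p where "\<And>i. i \<in> {1..m} \<Longrightarrow> linear (p i)"
    "\<And>i x. i \<in> {1..m} \<Longrightarrow> p i x \<in> \<xi> i"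
    "\<And>x. x = (\<Sum>i=1..m. p i x)"
    "\<And>f i. \<lbrakk>\<And>i. i \<in> {1..m} \<Longrightarrow> f i \<in> \<xi> i; i \<in> {1..m}\<rbrakk> \<Longrightarrow> p i (\<Sum>i=1..m. f i) = f i"
proof -
  have sub: "\<And>i. i \<in> {1..m} \<Longrightarrow> subspace (\<xi> i)"
    and ex: "\<And>x. \<exists>!f. f \<in> (\<Pi>\<^sub>E i\<in>{1..m}. \<xi> i) \<and> x = (\<Sum>i=1..m. f i)"
    using assms by (auto simp: direct_sum_decomposition_def)
  define p where "p i x = (THE f. f \<in> (\<Pi>\<^sub>E i\<in>{1..m}. \<xi> i) \<and> x = (\<Sum>i=1..m. f i)) i" for i x
  have P: "(\<lambda>i. p i x) \<in> (\<Pi>\<^sub>E i\<in>{1..m}. \<xi> i)" "x = (\<Sum>i=1..m. p i x)" for x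
    using theI'[OF ex[of x]] unfolding p_def by auto
  have mem: "p i x \<in> \<xi> i" if "i \<in> {1..m}" for i x using P(1)[of x] that by auto
  have uniq: "p i (\<Sum>i=1..m. f i) = f i"
    if f: "\<And>i. i \<in> {1..m} \<Longrightarrow> f i \<in> \<xi> i" and i: "i \<in> {1..m}" for f i
  proof -
    \<comment> \<open>Uniqueness holds among extensional functions only, so \<open>f\<close> is
      first made undefined outside the index range.\<close>
    let ?g = "restrict f {1..m}"
    have "?g \<in> (\<Pi>\<^sub>E i\<in>{1..m}. \<xi> i)" using f by auto
    moreover have "(\<Sum>i=1..m. f i) = (\<Sum>i=1..m. ?g i)" by (rule sum.cong) auto
    ultimately have "(\<lambda>i. p i (\<Sum>i=1..m. f i)) = ?g"
      using ex[of "\<Sum>i=1..m. f i"] P[of "\<Sum>i=1..m. f i"] by blast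
    then show ?thesis using i by (metis restrict_apply)
  qed
  have "linear (p i)" if i: "i \<in> {1..m}" for i
  proof (rule linearI)
    fix x y
    have "x + y = (\<Sum>i=1..m. p i x + p i y)" by (simp only: sum.distrib P(2)[symmetric])
    then show "p i (x + y) = p i x + p i y"
      using uniq[of "\<lambda>i. p i x + p i y" i] mem sub i by (metis (no_types, lifting) subspace_add)
  next
    fix c x
    have "c *\<^sub>R x = (\<Sum>i=1..m. c *\<^sub>R p i x)" by (simp only: scaleR_sum_right[symmetric] P(2)[symmetric])
    then show "p i (c *\<^sub>R x) = c *\<^sub>R p i x"
      using uniq[of "\<lambda>i. c *\<^sub>R p i x" i] mem sub i by (metis (no_types, lifting) subspace_scale)
  qed
  then show ?thesis using that mem uniq P(2) by blast
qed

text \<open>An exchange argument: \<open>u\<close> is maximal on the facet, so trading the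
  \<open>k\<close>-th summand of one facet point for that of another cannot increase it. By symmetry
  \<open>u\<close> composed with \<open>p\<close> is constant on the facet, and its representing
  vector is parallel to \<open>u\<close>.\<close>

lemma facet_normal_eigenvector:
  fixes Q :: "'a::euclidean_space set" and M :: "nat \<Rightarrow> 'a set"
  assumes Q: "interior Q \<noteq> {}" "Q = (\<Sum>i=1..m. M i)"
    and F: "F facet_of Q" "outer_normal Q F u"
    and p: "linear p" "\<And>f. (\<And>i. i \<in> {1..m} \<Longrightarrow> f i \<in> M i) \<Longrightarrow> p (\<Sum>i=1..m. f i) = f k"
    and k: "k \<in> {1..m}"
  shows "\<exists>\<alpha>. \<forall>x. u \<bullet> p x = \<alpha> * (u \<bullet> x)"
proof -
  obtain b where u: "u \<noteq> 0" "Q \<subseteq> {x. u \<bullet> x \<le> b}" "F = Q \<inter> {x. u \<bullet> x = b}"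
    using F(2) by (auto simp: outer_normal_def)
  have Qsum: "Q = {sum s {1..m} | s. \<forall>i\<in>{1..m}. s i \<in> M i}"
    unfolding Q(2) by (rule set_sum_alt) simp
  have le: "u \<bullet> p y \<le> u \<bullet> p x" if F: "x \<in> F" "y \<in> F" for x y
  proof -
    obtain f where f: "x = sum f {1..m}" "\<forall>i\<in>{1..m}. f i \<in> M i"
      using F u(3) Qsum by blast
    obtain g where g: "y = sum g {1..m}" "\<forall>i\<in>{1..m}. g i \<in> M i"
      using F u(3) Qsum by blast
    have "sum (f(k := g k)) {1..m} \<in> Q"
      unfolding Qsum using f g k by fastforce
    moreover have "sum (f(k := g k)) {1..m} = x - f k + g k"
      using k f(1) by (simp add: sum.remove[of _ k] sum.If_cases)
    ultimately have "u \<bullet> (x - f k + g k) \<le> b" using u(2) by auto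
    moreover have "u \<bullet> x = b" using F u(3) by auto
    ultimately have "u \<bullet> g k \<le> u \<bullet> f k" by (simp add: inner_diff_right inner_add_right)
    then show ?thesis using p(2)[of f] p(2)[of g] f g by auto
  qed
  obtain x0 where x0: "x0 \<in> F" using F(1) by (auto simp: facet_of_def)
  \<comment> \<open>The adjoint represents the functional by a vector that can be compared with the
    facet normal.\<close>
  have adj: "adjoint (p) u \<bullet> x = u \<bullet> p x" for x
    using adjoint_works[OF p(1), of x u] by (simp add: inner_commute)
  have "\<exists>\<alpha>. adjoint (p) u = \<alpha> *\<^sub>R u"
  proof (rule facet_normals_proportional[OF Q(1) F(1) u(1)])
    show "F \<subseteq> {x. u \<bullet> x = b}" using u(3) by blast
    show "F \<subseteq> {x. adjoint (p) u \<bullet> x = u \<bullet> p x0}"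
      using le x0 by (auto simp: adj intro: antisym)
  qed
  then show ?thesis using adj by (metis inner_scaleR_left)
qed

text \<open>At a basis vector e_a the pair sums over the triangle avoiding a vanish, hence so do the
  other three coordinates of its image. The eigenvalues of all three edges at a therefore equal the
  remaining coordinate. Neighbouring vertices share an edge, so there is one eigenvalue, and pair
  sums determine a vector.\<close>

lemma scalar_if_pair_sum_eigenvectors:
  fixes f :: "real ^ 4 \<Rightarrow> real ^ 4"
  assumes "\<And>i j. i \<noteq> j \<Longrightarrow> \<exists>\<alpha>. \<forall>x. pair_sum i j \<bullet> f x = \<alpha> * (pair_sum i j \<bullet> x)"
  shows "\<exists>\<alpha>. \<forall>x. f x = \<alpha> *\<^sub>R x"
proof -
  obtain \<alpha> where \<alpha>: "\<And>i j x. i \<noteq> j \<Longrightarrow> f x $ i + f x $ j = \<alpha> i j * (x $ i + x $ j)"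
    using assms unfolding inner_pair_sum by metis
  note eqs = \<alpha>[of 1 2] \<alpha>[of 1 3] \<alpha>[of 1 4] \<alpha>[of 2 3] \<alpha>[of 2 4] \<alpha>[of 3 4]
  have "\<alpha> 1 2 = \<alpha> 1 3 \<and> \<alpha> 1 2 = \<alpha> 1 4"
    using eqs[of "axis 1 1"] by (simp add: axis_def)
  moreover have "\<alpha> 1 2 = \<alpha> 2 3 \<and> \<alpha> 1 2 = \<alpha> 2 4"
    using eqs[of "axis 2 1"] by (simp add: axis_def)
  moreover have "\<alpha> 3 4 = \<alpha> 1 3"
    using eqs[of "axis 3 1"] by (simp add: axis_def)
  ultimately have "f x = \<alpha> 1 2 *\<^sub>R x" for x
    using eqs[of x] unfolding vec_eq_iff forall_4 by (simp add: algebra_simps)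
  then show ?thesis by blast
qed

lemma not_decomposable_if_pair_sum_normals:
  assumes int: "interior Q \<noteq> {}" and normals: "sgn ` normal_directions \<subseteq> unit_facet_normals Q"
  shows "\<not> decomposable 3 Q"
proof
  assume "decomposable 3 Q"
  then obtain m \<xi> M where dec: "direct_sum_decomposition m \<xi>"
    and \<xi>: "\<And>i. i \<in> {1..m} \<Longrightarrow> dim (\<xi> i) \<le> 3" and M: "\<And>i. i \<in> {1..m} \<Longrightarrow> M i \<subseteq> \<xi> i"
    and Q: "Q = (\<Sum>i=1..m. M i)"
    unfolding decomposable_def by blast
  obtain p where p: "\<And>i. i \<in> {1..m} \<Longrightarrow> linear (p i)"
    "\<And>i x. i \<in> {1..m} \<Longrightarrow> p i x \<in> \<xi> i"
    "\<And>x. x = (\<Sum>i=1..m. p i x)"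
    "\<And>f i. \<lbrakk>\<And>i. i \<in> {1..m} \<Longrightarrow> f i \<in> \<xi> i; i \<in> {1..m}\<rbrakk> \<Longrightarrow> p i (\<Sum>i=1..m. f i) = f i"
    using direct_sum_projections[OF dec] by metis
  have zero: "p k x = 0" if k: "k \<in> {1..m}" for k x
  proof -
    have "\<exists>\<alpha>. \<forall>x. pair_sum i j \<bullet> p k x = \<alpha> * (pair_sum i j \<bullet> x)" if "i \<noteq> j" for i j
    proof -
      have "pair_sum i j \<in> normal_directions"
        unfolding normal_directions_eq using that by blast
      then obtain F where F: "F facet_of Q" "outer_normal Q F (sgn (pair_sum i j))"
        using normals by (auto simp: unit_facet_normals_def)
      have "\<exists>\<alpha>. \<forall>x. sgn (pair_sum i j) \<bullet> p k x = \<alpha> * (sgn (pair_sum i j) \<bullet> x)"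
      proof (rule facet_normal_eigenvector[OF int Q F p(1)[OF k] _ k])
        fix f assume "\<And>i. i \<in> {1..m} \<Longrightarrow> f i \<in> M i"
        then show "p k (\<Sum>i=1..m. f i) = f k" using p(4)[of f k] M k by blast
      qed
      moreover have "pair_sum i j \<noteq> 0" using F(2) by (auto simp: outer_normal_def)
      ultimately show ?thesis by (simp add: sgn_div_norm)
    qed
    then obtain \<alpha> where \<alpha>: "\<And>x. p k x = \<alpha> *\<^sub>R x"
      using scalar_if_pair_sum_eigenvectors by metis
    have "\<alpha> = 0"
    proof (rule ccontr)
      assume "\<alpha> \<noteq> 0"
      \<comment> \<open>A nonzero scalar map is onto, which would make the summand
        \<open>\<xi> k\<close> four-dimensional.\<close>
      then have "x \<in> \<xi> k" for x using p(2)[OF k, of "(1 / \<alpha>) *\<^sub>R x"] \<alpha> by simp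
      then have "\<xi> k = UNIV" by blast
      then show False using \<xi>[OF k] by simp
    qed
    then show ?thesis using \<alpha> by simp
  qed
  \<comment> \<open>The component projections add up to the identity, yet all of them
    vanish.\<close>
  have "x = 0" for x :: "real ^ 4" using p(3)[of x] zero by simp
  from this[of "axis 1 1"] show False by simp
qed

section \<open>Full dimension from facet volume\<close>

text \<open>A lower-dimensional subset of 3-space lies in a plane and is null, while a linear
  isometric embedding followed by a translation preserves affine dimension.\<close>

lemma aff_dim_if_has_volume3:
  assumes "has_volume3 F v" "v \<noteq> 0"
  shows "aff_dim F = 3"
proof -
  obtain q and f :: "real ^ 3 \<Rightarrow> real ^ 4" and S where f: "linear f" "\<And>x. norm (f x) = norm x"
    and F: "F = (\<lambda>x. q + f x) ` S" and S: "measure lebesgue S = v"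
    using assms(1) by (auto simp: has_volume3_def)
  have "inj f" using f by (metis linear_injective_0 norm_eq_zero)
  have "F = (+) q ` (f ` S)" unfolding F by auto
  then have "aff_dim F = aff_dim S"
    by (simp only: aff_dim_translation_eq aff_dim_injective_linear_image[OF f(1) \<open>inj f\<close>])
  moreover have "\<not> aff_dim S < 3"
  proof
    assume "aff_dim S < 3"
    then obtain a b where "a \<noteq> 0" "S \<subseteq> {x. a \<bullet> x = b}"
      using aff_lowdim_subset_hyperplane[of S] by auto
    then have "negligible S" using negligible_hyperplane negligible_subset by blast
    then show False using S assms(2) negligible_imp_measure0 by blast
  qed
  ultimately show ?thesis using aff_dim_le_DIM[of S] by simp
qed

theorem mainTheorem9:
  fixes Q :: "(real ^ 4) set"
  assumes "minkowski_polytope_Q Q"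
  shows "reliable 3 Q \<and> \<not> decomposable 3 Q"
proof -
  have poly: "polyhedron Q" and card: "card {F. F facet_of Q} = 12"
    and normals: "unit_facet_normals Q = sgn ` normal_directions"
    and vol: "\<And>F. F facet_of Q \<Longrightarrow> has_volume3 F 1"
    using assms polytope_imp_polyhedron by (auto simp: minkowski_polytope_Q_def)
  \<comment> \<open>The facet count supplies one facet; it has dimension 3, one less than
    \<open>Q\<close>.\<close>
  have "{F. F facet_of Q} \<noteq> {}" using card by (metis card.empty zero_neq_numeral)
  then obtain F where F: "F facet_of Q" by blast
  then have "aff_dim Q = 4"
    using aff_dim_if_has_volume3[OF vol[OF F]] by (simp add: facet_of_def)
  have "interior Q \<noteq> {}"
  proof
    assume "interior Q = {}"
    then obtain a b where "a \<noteq> 0" "Q \<subseteq> {x. a \<bullet> x = b}"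
      using empty_interior_subset_hyperplane polyhedron_imp_convex[OF poly] by metis
    then have "aff_dim Q \<le> 3"
      using aff_dim_subset[of Q "{x. a \<bullet> x = b}"] by (simp add: aff_dim_hyperplane)
    with \<open>aff_dim Q = 4\<close> show False by simp
  qed
  then show ?thesis
    using reliable_if_pair_sum_normals[OF poly] not_decomposable_if_pair_sum_normals normals by simp
qed

end
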